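(* Let $u^n=\bar u^n+U^n(Y^n)^{\intercal}=\bar u^n+U_0S_0V_0^{\intercal}$ with $Y^n=V_0$ and $U^n=U_0S_0$. Let $u^{n+1}$ be computed from $u^n$ by Scheme A and $\hat u^{n+1}$ by Scheme B (the projector-splitting scheme), both described in the context, with the same evaluation term $\mathcal L(u^n,u^{n+1})$ and right-hand side $f^{n,n+1}$. If the matrix $\hat S_1$ arising in Scheme B is invertible, then the two schemes coincide (in exact arithmetic): $\hat u^{n+1}=u^{n+1}$.
   Context: Setting. $V,H$ are separable real Hilbert spaces forming a Gelfand triple $V\subset H\subset V'$; $(\cdot,\cdot)_{V'V}$ is the duality pairing, extending $\langle\cdot,\cdot\rangle_H$. $\hat\Gamma=\{\omega_1,\dots,\omega_{\hat N}\}$ is a finite set with weights $\lambda_k>0$, $\sum_k\lambda_k=1$; $L^2_{\hat\rho}$ is the space of real functions on $\hat\Gamma$ with $\langle v,w\rangle_{L^2_{\hat\rho}}=\sum_k\lambda_kv(\omega_k)w(\omega_k)$; $\mathbb E_{\hat\rho}[v]=\sum_k\lambda_kv(\omega_k)$ (also for vector-valued $v$); $L^2_{\hat\rho,0}$ is the subspace of zero-mean functions; $v^*=v-\mathbb E_{\hat\rho}[v]$. $V_h\subset V$ is finite-dimensional, $\dim V_h>R$, $R<\hat N$. $\triangle t>0$. $\mathcal L(u^n,u^{n+1}):\hat\Gamma\to V'$ and $f^{n,n+1}:\hat\Gamma\to H$ are the (explicit, implicit or semi-implicit) time evaluation of the operator and of the right-hand side; in both schemes they are the same functions. Put $G:=\mathcal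 L(u^n,u^{n+1})-f^{n,n+1}$. Tuples $U=(U_1,\dots,U_R)$, $Y=(Y_1,\dots,Y_R)$ are rows; $UY^{\intercal}=\sum_jU_jY_j$; $(G^*,U)_{V'V}$ is the row $((G^*,U_j)_{V'V})_j$. Scheme A. Given $u^n=\bar u^n+\sum_jU^n_jY^n_j$, $\bar u^n,U^n_j\in V_h$, $Y^n_j\in L^2_{\hat\rho,0}$ orthonormal: 1. $\bar u^{n+1}\in V_h$: $\langle\frac{\bar u^{n+1}-\bar u^n}{\triangle t},v_h\rangle_H+(\mathbb E_{\hat\rho}[G],v_h)_{V'V}=0$ for all $v_h\in V_h$. 2. $\tilde U^{n+1}_j\in V_h$: $\langle\frac{\tilde U^{n+1}_j-U^n_j}{\triangle t},v_h\rangle_H+(\mathbb E_{\hat\rho}[GY^n_j],v_h)_{V'V}=0$ for all $v_h\in V_h$, $j=1,\dots,R$. 3. $\tilde Y^{n+1}\in(L^2_{\hat\rho})^R$: $\frac{\tilde Y^{n+1}-Y^n}{\triangle t}\tilde M^{n+1}+\mathcal P^\perp_{\hat\rho,\mathcal Y^n}[(G^*,\tilde U^{n+1})_{V'V}]=0$, with $\tilde M^{n+1}_{ij}=\langle\tilde U^{n+1}_i,\tilde U^{n+1}_j\rangle_H$ and $\mathcal P^\perp_{\hat\rho,\mathcal Y^n}$ the $L^2_{\hat\rho}$-orthogonal projection onto the orthogonal complement of $\mathrm{span}\{Y^n_j\}$. 4. $u^{n+1}=\bar u^{n+1}+\sum_j\tilde U^{n+1}_j\tilde Y^{n+1}_j$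 (the zero-mean part being then rewritten as $\sum_jU^{n+1}_jY^{n+1}_j$ with orthonormal $Y^{n+1}_j$). Scheme B. Given $u^n=\bar u^n+U_0S_0V_0^{\intercal}$ with $U_0\in(V_h)^R$ orthonormal in $H$, $V_0\in(L^2_{\hat\rho,0})^R$ orthonormal in $L^2_{\hat\rho}$, $S_0\in\mathbb R^{R\times R}$: 1. $\hat{\bar u}^{n+1}\in V_h$: $\langle\hat{\bar u}^{n+1},v_h\rangle_H=\langle\bar u^n,v_h\rangle_H-\triangle t(\mathbb E_{\hat\rho}[G],v_h)_{V'V}$ for all $v_h\in V_h$. 2. $K_1\in(V_h)^R$: $\langle K_1,v_h\rangle_H=\langle U_0S_0,v_h\rangle_H-\triangle t(\mathbb E_{\hat\rho}[G^*V_0],v_h)_{V'V}$ for all $v_h\in V_h$ (componentwise). 3. $U_1\in(V_h)^R$, $\hat S_1\in\mathbb R^{R\times R}$ with $U_1\hat S_1=K_1$ and $U_1$ orthonormal in $\langle\cdot,\cdot\rangle_H$. 4. $\tilde S_0=\hat S_1+\triangle t\,(U_1^{\intercal},\mathbb E_{\hat\rho}[G^*V_0])_{V'V}$, i.e. $(\tilde S_0)_{ij}=(\hat S_1)_{ij}+\triangle t\,(\mathbb E_{\hat\rho}[G^*(V_0)_j],(U_1)_i)_{V'V}$. 5. $L_1=V_0\tilde S_0^{\intercal}-\triangle t\,(G^*,U_1)_{V'V}\in(L^2_{\hat\rho})^R$. 6. $V_1\in(L^2_{\hat\rho,0})^R$, $S_1\in\mathbb R^{R\times R}$ with $V_1S_1^{\intercal}=L_1$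 and $V_1$ orthonormal in $\langle\cdot,\cdot\rangle_{L^2_{\hat\rho}}$. The new solution is $\hat u^{n+1}=\hat{\bar u}^{n+1}+U_1S_1V_1^{\intercal}$. *)

theory Defs
  imports "HOL-Analysis.Analysis"
begin

text \<open>
  Conventions.  \<open>V\<close> and \<open>H\<close> are the types \<open>'v\<close> and \<open>'h\<close>; the inclusion of \<open>V\<close> in \<open>H\<close> is a map
  \<open>emb\<close>.  The dual \<open>V'\<close> is the type \<open>'v \<Rightarrow>\<^sub>L real\<close>, and the duality pairing is application.
  The finite sample set is \<open>\<Gamma> :: 'w set\<close> with weights \<open>wt\<close>; an element of the discrete \<open>L\<^sup>2\<close> space
  is a function \<open>'w \<Rightarrow> real\<close> of which only the values on \<open>\<Gamma>\<close> matter.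
  The rank \<open>R\<close> is the cardinality of the finite index type \<open>'r\<close>: an \<open>R\<close>-tuple is a function on
  \<open>'r\<close> and an \<open>R \<times> R\<close> matrix has type \<open>real^'r^'r\<close>.
\<close>

subsection \<open>Gelfand triple and approximation space\<close>

definition gelfand_triple ::
  "('v::{real_inner,complete_space,second_countable_topology}
    \<Rightarrow> 'h::{real_inner,complete_space,second_countable_topology}) \<Rightarrow> bool" where
  "gelfand_triple emb \<longleftrightarrow> bounded_linear emb \<and> inj emb \<and> closure (range emb) = UNIV"

definition inner_H :: "('v \<Rightarrow> 'h::real_inner) \<Rightarrow> 'v \<Rightarrow> 'v \<Rightarrow> real" where
  "inner_H emb u v = inner (emb u) (emb v)"

definition H_to_dual :: "('v::real_inner \<Rightarrow> 'h::real_inner) \<Rightarrow> 'h \<Rightarrow> ('v \<Rightarrow>\<^sub>L real)" where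
  "H_to_dual emb h = Blinfun (\<lambda>v. inner h (emb v))"

definition orthonormal_H :: "('v \<Rightarrow> 'h::real_inner) \<Rightarrow> ('r \<Rightarrow> 'v) \<Rightarrow> bool" where
  "orthonormal_H emb U \<longleftrightarrow> (\<forall>i j. inner_H emb (U i) (U j) = (if i = j then 1 else 0))"

definition finite_dim_subspace :: "'v::real_vector set \<Rightarrow> bool" where
  "finite_dim_subspace W \<longleftrightarrow> (\<exists>B. finite B \<and> span B = W)"

subsection \<open>The discrete probability space\<close>

definition prob_weights :: "'w set \<Rightarrow> ('w \<Rightarrow> real) \<Rightarrow> bool" where
  "prob_weights \<Gamma> wt \<longleftrightarrow> finite \<Gamma> \<and> (\<forall>\<omega>\<in>\<Gamma>. wt \<omega> > 0) \<and> (\<Sum>\<omega>\<in>\<Gamma>. wt \<omega>) = 1"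

definition expect :: "'w set \<Rightarrow> ('w \<Rightarrow> real) \<Rightarrow> ('w \<Rightarrow> 'b::real_vector) \<Rightarrow> 'b" where
  "expect \<Gamma> wt v = (\<Sum>\<omega>\<in>\<Gamma>. wt \<omega> *\<^sub>R v \<omega>)"

definition centered :: "'w set \<Rightarrow> ('w \<Rightarrow> real) \<Rightarrow> ('w \<Rightarrow> 'b::real_vector) \<Rightarrow> 'w \<Rightarrow> 'b" where
  "centered \<Gamma> wt v = (\<lambda>\<omega>. v \<omega> - expect \<Gamma> wt v)"

definition inner_L2 :: "'w set \<Rightarrow> ('w \<Rightarrow> real) \<Rightarrow> ('w \<Rightarrow> real) \<Rightarrow> ('w \<Rightarrow> real) \<Rightarrow> real" where
  "inner_L2 \<Gamma> wt v w = (\<Sum>\<omega>\<in>\<Gamma>. wt \<omega> * v \<omega> * w \<omega>)"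

definition orthonormal_L2 :: "'w set \<Rightarrow> ('w \<Rightarrow> real) \<Rightarrow> ('r \<Rightarrow> 'w \<Rightarrow> real) \<Rightarrow> bool" where
  "orthonormal_L2 \<Gamma> wt Y \<longleftrightarrow> (\<forall>i j. inner_L2 \<Gamma> wt (Y i) (Y j) = (if i = j then 1 else 0))"

definition zero_mean :: "'w set \<Rightarrow> ('w \<Rightarrow> real) \<Rightarrow> ('r \<Rightarrow> 'w \<Rightarrow> real) \<Rightarrow> bool" where
  "zero_mean \<Gamma> wt Y \<longleftrightarrow> (\<forall>j. expect \<Gamma> wt (Y j) = 0)"

definition span_L2 :: "('r::finite \<Rightarrow> 'w \<Rightarrow> real) \<Rightarrow> ('w \<Rightarrow> real) set" where
  "span_L2 Y = {(\<lambda>\<omega>. \<Sum>j\<in>UNIV. c j * Y j \<omega>) |c. True}"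

definition orth_compl_L2 ::
  "'w set \<Rightarrow> ('w \<Rightarrow> real) \<Rightarrow> ('w \<Rightarrow> real) set \<Rightarrow> ('w \<Rightarrow> real) set" where
  "orth_compl_L2 \<Gamma> wt S = {w. \<forall>s\<in>S. inner_L2 \<Gamma> wt w s = 0}"

text \<open>The choice below is unique as far as the values on \<open>\<Gamma>\<close> are concerned, since
  \<open>inner_L2\<close> is positive definite there.\<close>

definition orth_proj_L2 ::
  "'w set \<Rightarrow> ('w \<Rightarrow> real) \<Rightarrow> ('w \<Rightarrow> real) set \<Rightarrow> ('w \<Rightarrow> real) \<Rightarrow> 'w \<Rightarrow> real" where
  "orth_proj_L2 \<Gamma> wt W v =
     (SOME p. p \<in> W \<and> (\<forall>w\<in>W. inner_L2 \<Gamma> wt (\<lambda>\<omega>. v \<omega> - p \<omega>) w = 0))"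

subsection \<open>Row tuples\<close>

definition row_mult :: "('r::finite \<Rightarrow> 'b::real_vector) \<Rightarrow> real^'r^'r \<Rightarrow> 'r \<Rightarrow> 'b" where
  "row_mult U A = (\<lambda>j. \<Sum>i\<in>UNIV. (A $ i $ j) *\<^sub>R U i)"

definition row_mult_L2 ::
  "('r::finite \<Rightarrow> 'w \<Rightarrow> real) \<Rightarrow> real^'r^'r \<Rightarrow> 'r \<Rightarrow> 'w \<Rightarrow> real" where
  "row_mult_L2 Y A = (\<lambda>j \<omega>. row_mult (\<lambda>i. Y i \<omega>) A j)"

definition combine ::
  "('r::finite \<Rightarrow> 'v::real_vector) \<Rightarrow> ('r \<Rightarrow> 'w \<Rightarrow> real) \<Rightarrow> 'w \<Rightarrow> 'v" where
  "combine U Y = (\<lambda>\<omega>. \<Sum>j\<in>UNIV. Y j \<omega> *\<^sub>R U j)"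

definition gram_H :: "('v \<Rightarrow> 'h::real_inner) \<Rightarrow> ('r \<Rightarrow> 'v) \<Rightarrow> real^'r^'r" where
  "gram_H emb U = (\<chi> i j. inner_H emb (U i) (U j))"

definition pairing_row ::
  "('w \<Rightarrow> ('v::real_normed_vector \<Rightarrow>\<^sub>L real)) \<Rightarrow> ('r \<Rightarrow> 'v) \<Rightarrow> 'r \<Rightarrow> 'w \<Rightarrow> real" where
  "pairing_row G U = (\<lambda>j \<omega>. blinfun_apply (G \<omega>) (U j))"

subsection \<open>The two schemes\<close>

text \<open>
  Both schemes take the evaluated operator \<open>Lop\<close> (standing for \<open>\<L>(u\<^sup>n, u\<^sup>n\<^sup>+\<^sup>1)\<close>) and the evaluated
  right-hand side \<open>f\<close> as given functions on \<open>\<Gamma>\<close>; being arbitrary, they cover explicit, implicit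
  and semi-implicit time evaluations.
\<close>

definition residual ::
  "('v::real_inner \<Rightarrow> 'h::real_inner) \<Rightarrow> ('w \<Rightarrow> ('v \<Rightarrow>\<^sub>L real)) \<Rightarrow> ('w \<Rightarrow> 'h) \<Rightarrow> 'w \<Rightarrow> ('v \<Rightarrow>\<^sub>L real)"
  where "residual emb Lop f = (\<lambda>\<omega>. Lop \<omega> - H_to_dual emb (f \<omega>))"

text \<open>
  \<open>scheme_A\<close>: from \<open>un = mn + Uo Yo\<^sup>T\<close> to \<open>unew = mnew + Ut Yt\<^sup>T\<close>.  The subsequent rewriting
  of \<open>Ut Yt\<^sup>T\<close> with orthonormal stochastic modes does not change \<open>unew\<close> and is not recorded.
\<close>

definition scheme_A ::
  "('v::{real_inner,complete_space,second_countable_topology}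
     \<Rightarrow> 'h::{real_inner,complete_space,second_countable_topology})
   \<Rightarrow> 'w set \<Rightarrow> ('w \<Rightarrow> real) \<Rightarrow> 'v set \<Rightarrow> real \<Rightarrow> ('w \<Rightarrow> ('v \<Rightarrow>\<^sub>L real)) \<Rightarrow> ('w \<Rightarrow> 'h)
   \<Rightarrow> ('w \<Rightarrow> 'v) \<Rightarrow> 'v \<Rightarrow> ('r::finite \<Rightarrow> 'v) \<Rightarrow> ('r \<Rightarrow> 'w \<Rightarrow> real)
   \<Rightarrow> 'v \<Rightarrow> ('r \<Rightarrow> 'v) \<Rightarrow> ('r \<Rightarrow> 'w \<Rightarrow> real) \<Rightarrow> ('w \<Rightarrow> 'v) \<Rightarrow> bool" where
  "scheme_A emb \<Gamma> wt Vh dt Lop f un mn Uo Yo mnew Ut Yt unew \<longleftrightarrow>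
    (let G = residual emb Lop f; Gs = centered \<Gamma> wt G in
      mn \<in> Vh \<and> range Uo \<subseteq> Vh \<and> zero_mean \<Gamma> wt Yo \<and> orthonormal_L2 \<Gamma> wt Yo \<and>
      (\<forall>\<omega>\<in>\<Gamma>. un \<omega> = mn + combine Uo Yo \<omega>) \<and>
      mnew \<in> Vh \<and>
      (\<forall>vh\<in>Vh. inner_H emb ((mnew - mn) /\<^sub>R dt) vh
                 + blinfun_apply (expect \<Gamma> wt G) vh = 0) \<and>
      range Ut \<subseteq> Vh \<and>
      (\<forall>j. \<forall>vh\<in>Vh. inner_H emb ((Ut j - Uo j) /\<^sub>R dt) vh
                 + blinfun_apply (expect \<Gamma> wt (\<lambda>\<omega>. Yo j \<omega> *\<^sub>R G \<omega>)) vh = 0) \<and>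
      (\<forall>j. \<forall>\<omega>\<in>\<Gamma>.
         row_mult_L2 (\<lambda>k \<omega>. (Yt k \<omega> - Yo k \<omega>) / dt) (gram_H emb Ut) j \<omega>
         + orth_proj_L2 \<Gamma> wt (orth_compl_L2 \<Gamma> wt (span_L2 Yo)) (pairing_row Gs Ut j) \<omega> = 0) \<and>
      (\<forall>\<omega>\<in>\<Gamma>. unew \<omega> = mnew + combine Ut Yt \<omega>))"

text \<open>
  \<open>scheme_B\<close>: from \<open>un = mn + U0 S0 V0\<^sup>T\<close> to \<open>unew = mnew + U1 S1 V1\<^sup>T\<close>; \<open>Sh1\<close> and \<open>St0\<close> are the
  matrices \<open>S\<close> with a hat (index 1) and with a tilde (index 0).
\<close>

definition scheme_B ::
  "('v::{real_inner,complete_space,second_countable_topology}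
     \<Rightarrow> 'h::{real_inner,complete_space,second_countable_topology})
   \<Rightarrow> 'w set \<Rightarrow> ('w \<Rightarrow> real) \<Rightarrow> 'v set \<Rightarrow> real \<Rightarrow> ('w \<Rightarrow> ('v \<Rightarrow>\<^sub>L real)) \<Rightarrow> ('w \<Rightarrow> 'h)
   \<Rightarrow> ('w \<Rightarrow> 'v) \<Rightarrow> 'v \<Rightarrow> ('r::finite \<Rightarrow> 'v) \<Rightarrow> real^'r^'r \<Rightarrow> ('r \<Rightarrow> 'w \<Rightarrow> real)
   \<Rightarrow> 'v \<Rightarrow> ('r \<Rightarrow> 'v) \<Rightarrow> ('r \<Rightarrow> 'v) \<Rightarrow> real^'r^'r \<Rightarrow> real^'r^'r \<Rightarrow> ('r \<Rightarrow> 'w \<Rightarrow> real)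
   \<Rightarrow> ('r \<Rightarrow> 'w \<Rightarrow> real) \<Rightarrow> real^'r^'r \<Rightarrow> ('w \<Rightarrow> 'v) \<Rightarrow> bool" where
  "scheme_B emb \<Gamma> wt Vh dt Lop f un mn U0 S0 V0 mnew K1 U1 Sh1 St0 L1 V1 S1 unew \<longleftrightarrow>
    (let G = residual emb Lop f; Gs = centered \<Gamma> wt G in
      mn \<in> Vh \<and> range U0 \<subseteq> Vh \<and> orthonormal_H emb U0 \<and>
      zero_mean \<Gamma> wt V0 \<and> orthonormal_L2 \<Gamma> wt V0 \<and>
      (\<forall>\<omega>\<in>\<Gamma>. un \<omega> = mn + combine (row_mult U0 S0) V0 \<omega>) \<and>
      mnew \<in> Vh \<and>
      (\<forall>vh\<in>Vh. inner_H emb mnew vh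
                 = inner_H emb mn vh - dt * blinfun_apply (expect \<Gamma> wt G) vh) \<and>
      range K1 \<subseteq> Vh \<and>
      (\<forall>j. \<forall>vh\<in>Vh. inner_H emb (K1 j) vh
                 = inner_H emb (row_mult U0 S0 j) vh
                   - dt * blinfun_apply (expect \<Gamma> wt (\<lambda>\<omega>. V0 j \<omega> *\<^sub>R Gs \<omega>)) vh) \<and>
      range U1 \<subseteq> Vh \<and> row_mult U1 Sh1 = K1 \<and> orthonormal_H emb U1 \<and>
      (\<forall>i j. St0 $ i $ j
                 = Sh1 $ i $ j + dt * blinfun_apply (expect \<Gamma> wt (\<lambda>\<omega>. V0 j \<omega> *\<^sub>R Gs \<omega>)) (U1 i)) \<and>
      (\<forall>j. \<forall>\<omega>\<in>\<Gamma>. L1 j \<omega> = row_mult_L2 V0 (transpose St0) j \<omega> - dt * pairing_row Gs U1 j \<omega>) \<and>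
      zero_mean \<Gamma> wt V1 \<and> orthonormal_L2 \<Gamma> wt V1 \<and>
      (\<forall>j. \<forall>\<omega>\<in>\<Gamma>. row_mult_L2 V1 (transpose S1) j \<omega> = L1 j \<omega>) \<and>
      (\<forall>\<omega>\<in>\<Gamma>. unew \<omega> = mnew + combine (row_mult U1 S1) V1 \<omega>))"

end

theory Submission
  imports Defs
begin

text \<open>
  Since the stochastic modes have zero mean, replacing \<open>G\<close> by its centered part does not change the
  equation for \<open>K1\<close>, so uniqueness of Galerkin solutions gives equal means and \<open>Ut = K1 = U1 Sh1\<close>
  with \<open>Sh1\<close> invertible.  The Gram matrix of \<open>Ut\<close> is then \<open>Sh1\<^sup>T Sh1\<close>, and cancelling \<open>Sh1\<^sup>T\<close> in the
  equation for the stochastic modes of Scheme A leaves exactly the formula for \<open>L1\<close>: up to the factor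
  \<open>dt\<close>, the component of the pairing \<open>(G\<^sup>*, U1)\<close> along \<open>V0\<close> is the correction \<open>St0 - Sh1\<close> of Scheme B.
\<close>

lemma inner_L2_diff_left:
  "inner_L2 \<Gamma> wt (\<lambda>\<omega>. v \<omega> - w \<omega>) u = inner_L2 \<Gamma> wt v u - inner_L2 \<Gamma> wt w u"
  by (simp add: inner_L2_def algebra_simps sum_subtractf)

lemma inner_L2_commute: "inner_L2 \<Gamma> wt v w = inner_L2 \<Gamma> wt w v"
  by (simp add: inner_L2_def algebra_simps)

lemma inner_L2_combination_left:
  fixes Y :: "'r::finite \<Rightarrow> 'w \<Rightarrow> real"
  shows "inner_L2 \<Gamma> wt (\<lambda>\<omega>. \<Sum>k\<in>UNIV. c k * Y k \<omega>) u = (\<Sum>k\<in>UNIV. c k * inner_L2 \<Gamma> wt (Y k) u)"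
  unfolding inner_L2_def sum_distrib_left sum_distrib_right
  by (subst sum.swap) (simp add: algebra_simps)

lemma inner_L2_cong:
  assumes "\<And>\<omega>. \<omega> \<in> \<Gamma> \<Longrightarrow> v \<omega> = v' \<omega>" "\<And>\<omega>. \<omega> \<in> \<Gamma> \<Longrightarrow> w \<omega> = w' \<omega>"
  shows "inner_L2 \<Gamma> wt v w = inner_L2 \<Gamma> wt v' w'"
  using assms by (simp add: inner_L2_def)

text \<open>Positive weights make every summand nonnegative, so all of them vanish. This
  definiteness on \<open>\<Gamma>\<close> is what pins down the choice in
  \<open>orth_proj_L2\<close>.\<close>

lemma inner_L2_self_eq_0D:
  assumes "prob_weights \<Gamma> wt" "inner_L2 \<Gamma> wt v v = 0" "\<omega> \<in> \<Gamma>"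
  shows "v \<omega> = 0"
proof -
  have "\<forall>\<omega>\<in>\<Gamma>. wt \<omega> * v \<omega> * v \<omega> = 0"
    using assms(1,2) unfolding inner_L2_def prob_weights_def
    by (subst (asm) sum_nonneg_eq_0_iff) (auto simp: mult.assoc zero_le_mult_iff intro: less_imp_le)
  with assms(1,3) show ?thesis
    by (fastforce simp: prob_weights_def)
qed

text \<open>Subtracting the Fourier sum along \<open>Y\<close> gives one candidate for the
  projection; definiteness shows that the chosen one agrees with it on \<open>\<Gamma>\<close>.
  Outside \<open>\<Gamma>\<close> the choice is arbitrary, hence the pointwise form.\<close>

lemma orth_proj_L2_orth_compl_span:
  fixes Y :: "'r::finite \<Rightarrow> 'w \<Rightarrow> real"
  assumes wt: "prob_weights \<Gamma> wt" and Y: "orthonormal_L2 \<Gamma> wt Y" and \<omega>: "\<omega> \<in> \<Gamma>"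
  shows "orth_proj_L2 \<Gamma> wt (orth_compl_L2 \<Gamma> wt (span_L2 Y)) v \<omega>
           = v \<omega> - (\<Sum>k\<in>UNIV. inner_L2 \<Gamma> wt v (Y k) * Y k \<omega>)"
proof -
  let ?W = "orth_compl_L2 \<Gamma> wt (span_L2 Y)"
  let ?s = "\<lambda>\<omega>. \<Sum>k\<in>UNIV. inner_L2 \<Gamma> wt v (Y k) * Y k \<omega>"
  let ?q = "\<lambda>\<omega>. v \<omega> - ?s \<omega>"
  define P where "P p \<longleftrightarrow> p \<in> ?W \<and> (\<forall>w\<in>?W. inner_L2 \<Gamma> wt (\<lambda>\<omega>. v \<omega> - p \<omega>) w = 0)" for p
  have qY: "inner_L2 \<Gamma> wt ?q (Y j) = 0" for j
    using Y by (simp add: inner_L2_diff_left inner_L2_combination_left orthonormal_L2_def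
        if_distrib[of "(*) _"] cong: if_cong)
  have "inner_L2 \<Gamma> wt ?q (\<lambda>\<omega>. \<Sum>k\<in>UNIV. c k * Y k \<omega>) = 0" for c
    unfolding inner_L2_commute[of \<Gamma> wt ?q] inner_L2_combination_left
    unfolding inner_L2_commute[of \<Gamma> wt _ ?q] qY by simp
  then have "?q \<in> ?W"
    unfolding orth_compl_L2_def span_L2_def by blast
  moreover have "inner_L2 \<Gamma> wt ?s w = 0" if "w \<in> ?W" for w
  proof -
    have "?s \<in> span_L2 Y"
      unfolding span_L2_def by (auto intro: exI[of _ "\<lambda>k. inner_L2 \<Gamma> wt v (Y k)"])
    with that show ?thesis
      unfolding orth_compl_L2_def by (simp add: inner_L2_commute[of \<Gamma> wt w])
  qed
  ultimately have q: "P ?q"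
    by (simp add: P_def)
  define p where "p = orth_proj_L2 \<Gamma> wt ?W v"
  have p: "P p"
    using q someI[of P] unfolding p_def orth_proj_L2_def P_def by blast
  \<comment> \<open>Two candidates differ by an element of \<open>?W\<close>. Testing both
    orthogonality conditions with this difference shows that it is orthogonal to itself.\<close>
  let ?d = "\<lambda>\<omega>. p \<omega> - ?q \<omega>"
  have "?d \<in> ?W"
    using p q unfolding P_def orth_compl_L2_def by (simp add: inner_L2_diff_left)
  with p q have "inner_L2 \<Gamma> wt (\<lambda>\<omega>. v \<omega> - p \<omega>) ?d = 0" "inner_L2 \<Gamma> wt (\<lambda>\<omega>. v \<omega> - ?q \<omega>) ?d = 0"
    unfolding P_def by blast+
  then have "inner_L2 \<Gamma> wt ?d ?d = 0"
    by (simp only: inner_L2_diff_left)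
  from inner_L2_self_eq_0D[OF wt this \<omega>] show ?thesis
    by (simp add: p_def)
qed

text \<open>The difference \<open>x - y\<close> is itself an admissible test vector, so its image in
  \<open>H\<close> has norm zero.\<close>

lemma galerkin_unique:
  assumes emb: "linear emb" "inj emb" and "subspace W" "x \<in> W" "y \<in> W"
    and eq: "\<And>v. v \<in> W \<Longrightarrow> inner_H emb x v = inner_H emb y v"
  shows "x = y"
proof -
  have "x - y \<in> W"
    using assms by (simp add: subspace_diff)
  from eq[OF this] have "inner (emb x - emb y) (emb x - emb y) = 0"
    by (simp add: inner_H_def linear_diff[OF emb(1)] inner_diff_left)
  with emb(2) show ?thesis
    by (simp add: inj_eq)
qed

lemma expect_cong:
  assumes "\<And>\<omega>. \<omega> \<in> \<Gamma> \<Longrightarrow> v \<omega> = w \<omega>"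
  shows "expect \<Gamma> wt v = expect \<Gamma> wt w"
  using assms by (simp add: expect_def)

text \<open>Centering subtracts a constant, which factors out of the expectation and is multiplied
  by the mean of \<open>Y\<close>. This reconciles \<open>G\<close> in Scheme A with its centered
  part in Scheme B.\<close>

lemma expect_mult_centered:
  assumes "expect \<Gamma> wt Y = 0"
  shows "expect \<Gamma> wt (\<lambda>\<omega>. Y \<omega> *\<^sub>R centered \<Gamma> wt G \<omega>) = expect \<Gamma> wt (\<lambda>\<omega>. Y \<omega> *\<^sub>R G \<omega>)"
proof -
  have "expect \<Gamma> wt (\<lambda>\<omega>. Y \<omega> *\<^sub>R centered \<Gamma> wt G \<omega>)
          = expect \<Gamma> wt (\<lambda>\<omega>. Y \<omega> *\<^sub>R G \<omega>) - expect \<Gamma> wt Y *\<^sub>R expect \<Gamma> wt G"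
    \<comment> \<open>The instantiations unfold only the expectations of the products and of
      \<open>Y\<close>; the mean of \<open>G\<close> stays an opaque constant.\<close>
    unfolding centered_def expect_def[of _ _ "\<lambda>\<omega>. Y \<omega> *\<^sub>R _ \<omega>"] expect_def[of _ _ Y]
    by (simp add: expect_def[of _ _ "\<lambda>\<omega>. Y \<omega> *\<^sub>R (_ \<omega> - _)"] scaleR_diff_right sum_subtractf
        scaleR_sum_left)
  with assms show ?thesis by simp
qed

text \<open>Links the dual-valued expectations of the schemes to the Fourier coefficients in the
  projection.\<close>

lemma blinfun_apply_expect_scaleR:
  "blinfun_apply (expect \<Gamma> wt (\<lambda>\<omega>. Y \<omega> *\<^sub>R G \<omega>)) u = inner_L2 \<Gamma> wt (\<lambda>\<omega>. blinfun_apply (G \<omega>) u) Y"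
  by (simp add: expect_def inner_L2_def blinfun.sum_left blinfun.scaleR_left algebra_simps)

lemma gram_H_row_mult_orthonormal:
  fixes A :: "real^'r::finite^'r"
  assumes "linear emb" "orthonormal_H emb U"
  shows "gram_H emb (row_mult U A) = transpose A ** A"
proof -
  have "inner_H emb (row_mult U A i) (row_mult U A j) = (\<Sum>l\<in>UNIV. A $ l $ i * A $ l $ j)" for i j
  proof -
    have "inner_H emb (row_mult U A i) (row_mult U A j)
        = (\<Sum>l\<in>UNIV. \<Sum>m\<in>UNIV. A $ l $ i * (A $ m $ j * inner_H emb (U l) (U m)))"
      using assms(1)
      by (simp add: inner_H_def row_mult_def linear_sum linear_scale inner_sum_left inner_sum_right
          sum_distrib_left)
         (subst sum.swap, simp add: algebra_simps)
    also have "\<dots> = (\<Sum>l\<in>UNIV. A $ l $ i * A $ l $ j)"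
      using assms(2) by (simp add: orthonormal_H_def if_distrib[of "(*) _"] cong: if_cong)
    finally show ?thesis .
  qed
  then show ?thesis
    by (simp add: gram_H_def matrix_matrix_mult_def transpose_def vec_eq_iff)
qed

text \<open>Transposing rows into columns turns the equations for the stochastic modes, at a fixed
  sample, into matrix-vector equations.\<close>

lemma row_mult_eq_matrix_vector:
  fixes y :: "'r::finite \<Rightarrow> real"
  shows "row_mult y A j = (transpose A *v (\<chi> i. y i)) $ j"
  by (simp add: row_mult_def matrix_vector_mult_def transpose_def)

text \<open>Associativity: the combination depends on \<open>A\<close> and \<open>Y\<close> only
  through the vector of coefficients with respect to \<open>U\<close>.\<close>

lemma combine_row_mult:
  "combine (row_mult U A) Y \<omega> = (\<Sum>i\<in>UNIV. (A *v (\<chi> j. Y j \<omega>)) $ i *\<^sub>R U i)"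
  unfolding combine_def row_mult_def matrix_vector_mult_def scaleR_sum_right
  by (subst sum.swap) (simp add: scaleR_sum_left mult.commute)

lemma pairing_row_row_mult:
  "pairing_row G (row_mult U A) j \<omega> = (transpose A *v (\<chi> i. pairing_row G U i \<omega>)) $ j"
  by (simp add: pairing_row_def row_mult_def matrix_vector_mult_def transpose_def
      blinfun.sum_right blinfun.scaleR_right)

theorem mainTheorem9:
  fixes emb :: "'v::{real_inner,complete_space,second_countable_topology}
                 \<Rightarrow> 'h::{real_inner,complete_space,second_countable_topology}"
    and \<Gamma> :: "'w set" and wt :: "'w \<Rightarrow> real"
    and Vh :: "'v set" and dt :: real
    and Lop :: "'w \<Rightarrow> ('v \<Rightarrow>\<^sub>L real)" and f :: "'w \<Rightarrow> 'h"
    and un unew unew_hat :: "'w \<Rightarrow> 'v"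
    and mn mnew mnew_hat :: 'v
    and Uo Ut U0 K1 U1 :: "'r::finite \<Rightarrow> 'v"
    and Yo Yt V0 L1 V1 :: "'r \<Rightarrow> 'w \<Rightarrow> real"
    and S0 Sh1 St0 S1 :: "real^'r^'r"
  assumes "gelfand_triple emb"
    and "prob_weights \<Gamma> wt"
    and "finite_dim_subspace Vh" and "dim Vh > CARD('r)" and "CARD('r) < card \<Gamma>"
    and "dt > 0"
    and "\<And>j \<omega>. \<omega> \<in> \<Gamma> \<Longrightarrow> Yo j \<omega> = V0 j \<omega>"
    and "Uo = row_mult U0 S0"
    and "scheme_A emb \<Gamma> wt Vh dt Lop f un mn Uo Yo mnew Ut Yt unew"
    and "scheme_B emb \<Gamma> wt Vh dt Lop f un mn U0 S0 V0
           mnew_hat K1 U1 Sh1 St0 L1 V1 S1 unew_hat"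
    and "invertible Sh1"
  shows "\<forall>\<omega>\<in>\<Gamma>. unew_hat \<omega> = unew \<omega>"
proof
  fix \<omega> assume \<omega>: "\<omega> \<in> \<Gamma>"
  define G where "G = residual emb Lop f"
  define Gs where "Gs = centered \<Gamma> wt G"
  define g where "g x = (\<chi> i. pairing_row Gs U1 i x)" for x
  define E where "E j = expect \<Gamma> wt (\<lambda>x. V0 j x *\<^sub>R Gs x)" for j
  \<comment> \<open>Column \<open>k\<close> of \<open>C\<close> holds the Fourier coefficients along
    \<open>V0 k\<close> of the pairings of \<open>Gs\<close> with the modes
    \<open>U1\<close>.\<close>
  define C where "C = (\<chi> i k. blinfun_apply (E k) (U1 i))"
  define v0 yt where "v0 = (\<chi> k. V0 k \<omega>)" and "yt = (\<chi> k. Yt k \<omega>)"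
  note A = assms(9)[unfolded scheme_A_def Let_def, folded G_def, folded Gs_def]
  note B = assms(10)[unfolded scheme_B_def Let_def, folded G_def, folded Gs_def, folded E_def]
  have Yo: "orthonormal_L2 \<Gamma> wt Yo"
    and Ut_Vh: "range Ut \<subseteq> Vh"
    and Ut_eq: "\<forall>j. \<forall>vh\<in>Vh. inner_H emb ((Ut j - Uo j) /\<^sub>R dt) vh
          + blinfun_apply (expect \<Gamma> wt (\<lambda>\<omega>. Yo j \<omega> *\<^sub>R G \<omega>)) vh = 0"
    and A_modes: "\<forall>j. \<forall>\<omega>\<in>\<Gamma>.
       row_mult_L2 (\<lambda>k \<omega>. (Yt k \<omega> - Yo k \<omega>) / dt) (gram_H emb Ut) j \<omega>
       + orth_proj_L2 \<Gamma> wt (orth_compl_L2 \<Gamma> wt (span_L2 Yo)) (pairing_row Gs Ut j) \<omega> = 0"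
    and unew: "\<forall>\<omega>\<in>\<Gamma>. unew \<omega> = mnew + combine Ut Yt \<omega>"
    using A by blast+
  have V0: "zero_mean \<Gamma> wt V0"
    and K1_Vh: "range K1 \<subseteq> Vh"
    and K1_eq: "\<forall>j. \<forall>vh\<in>Vh. inner_H emb (K1 j) vh
          = inner_H emb (row_mult U0 S0 j) vh - dt * blinfun_apply (E j) vh"
    and U1: "orthonormal_H emb U1" and K1: "row_mult U1 Sh1 = K1"
    and St0_entries: "\<forall>i j. St0 $ i $ j = Sh1 $ i $ j + dt * blinfun_apply (E j) (U1 i)"
    and L1_def: "\<forall>j. \<forall>\<omega>\<in>\<Gamma>. L1 j \<omega>
        = row_mult_L2 V0 (transpose St0) j \<omega> - dt * pairing_row Gs U1 j \<omega>"
    and V1: "\<forall>j. \<forall>\<omega>\<in>\<Gamma>. row_mult_L2 V1 (transpose S1) j \<omega> = L1 j \<omega>"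
    and unew_hat: "\<forall>\<omega>\<in>\<Gamma>. unew_hat \<omega> = mnew_hat + combine (row_mult U1 S1) V1 \<omega>"
    using B by blast+
  have emb: "linear emb" "inj emb"
    using assms(1) by (auto simp: gelfand_triple_def intro: bounded_linear.linear)
  have sub: "subspace Vh"
    using assms(3) by (auto simp: finite_dim_subspace_def)
  \<comment> \<open>Brings the difference quotients of Scheme A into the explicit form used by
    Scheme B.\<close>
  have step: "inner_H emb x v = inner_H emb y v - dt * c"
    if "inner_H emb ((x - y) /\<^sub>R dt) v + c = 0" for x y v c
    using that \<open>dt > 0\<close>
    by (simp add: inner_H_def linear_scale[OF emb(1)] linear_diff[OF emb(1)] inner_diff_left field_simps)

  have means: "mnew = mnew_hat"
  proof (rule galerkin_unique[OF emb sub])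
    show "mnew \<in> Vh" "mnew_hat \<in> Vh" using A B by blast+
    show "inner_H emb mnew v = inner_H emb mnew_hat v" if "v \<in> Vh" for v
    proof -
      have "inner_H emb ((mnew - mn) /\<^sub>R dt) v + blinfun_apply (expect \<Gamma> wt G) v = 0"
        using A that by blast
      moreover have "inner_H emb mnew_hat v = inner_H emb mn v - dt * blinfun_apply (expect \<Gamma> wt G) v"
        using B that by blast
      ultimately show ?thesis
        using step by simp
    qed
  qed

  have E_eq: "expect \<Gamma> wt (\<lambda>x. Yo j x *\<^sub>R G x) = E j" for j
  proof -
    have "expect \<Gamma> wt (V0 j) = 0"
      using V0 by (simp add: zero_mean_def)
    then have "E j = expect \<Gamma> wt (\<lambda>x. V0 j x *\<^sub>R G x)"
      unfolding E_def Gs_def by (rule expect_mult_centered)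
    with assms(7) show ?thesis
      by (simp cong: expect_cong)
  qed
  have "Ut j = K1 j" for j
  proof (rule galerkin_unique[OF emb sub])
    show "Ut j \<in> Vh" "K1 j \<in> Vh" using Ut_Vh K1_Vh by auto
    show "inner_H emb (Ut j) v = inner_H emb (K1 j) v" if "v \<in> Vh" for v
    proof -
      have "inner_H emb ((Ut j - Uo j) /\<^sub>R dt) v + blinfun_apply (E j) v = 0"
        using Ut_eq that by (simp add: E_eq)
      moreover have "inner_H emb (K1 j) v = inner_H emb (Uo j) v - dt * blinfun_apply (E j) v"
        using K1_eq that by (simp add: assms(8))
      ultimately show ?thesis
        using step by simp
    qed
  qed
  then have Ut: "Ut = row_mult U1 Sh1"
    using K1 by auto
  have gram: "gram_H emb Ut = transpose Sh1 ** Sh1"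
    unfolding Ut by (intro gram_H_row_mult_orthonormal emb U1)

  \<comment> \<open>Since \<open>Ut\<close> is \<open>U1\<close> times \<open>Sh1\<close>, both the
    pairing and its component along \<open>V0\<close> carry the left factor
    \<open>transpose Sh1\<close>.\<close>
  have proj: "orth_proj_L2 \<Gamma> wt (orth_compl_L2 \<Gamma> wt (span_L2 Yo)) (pairing_row Gs Ut j) \<omega>
      = (transpose Sh1 *v (g \<omega> - C *v v0)) $ j" for j
  proof -
    have "inner_L2 \<Gamma> wt (pairing_row Gs Ut j) (Yo k) = (transpose Sh1 ** C) $ j $ k" for k
    proof -
      have "inner_L2 \<Gamma> wt (pairing_row Gs Ut j) (Yo k) = inner_L2 \<Gamma> wt (pairing_row Gs Ut j) (V0 k)"
        using assms(7) by (intro inner_L2_cong) auto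
      also have "\<dots> = blinfun_apply (E k) (Ut j)"
        by (simp add: E_def pairing_row_def blinfun_apply_expect_scaleR)
      also have "\<dots> = (transpose Sh1 ** C) $ j $ k"
        by (simp add: Ut row_mult_def C_def matrix_matrix_mult_def transpose_def
            blinfun.sum_right blinfun.scaleR_right)
      finally show ?thesis .
    qed
    then have "(\<Sum>k\<in>UNIV. inner_L2 \<Gamma> wt (pairing_row Gs Ut j) (Yo k) * Yo k \<omega>)
        = ((transpose Sh1 ** C) *v v0) $ j"
      using assms(7)[OF \<omega>] by (simp add: matrix_vector_mult_def v0_def)
    then show ?thesis
      by (simp add: orth_proj_L2_orth_compl_span[OF assms(2) Yo \<omega>] Ut pairing_row_row_mult g_def
          matrix_vector_mult_diff_distrib matrix_vector_mul_assoc)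
  qed

  \<comment> \<open>The Gram matrix and the projected pairing share the factor
    \<open>transpose Sh1\<close>, which is cancelled by invertibility. The remaining
    \<open>Sh1\<close> is kept, because the new solution contains \<open>yt\<close> only through
    \<open>Sh1 *v yt\<close>.\<close>
  have modes: "Sh1 *v (yt - v0) = - dt *\<^sub>R (g \<omega> - C *v v0)"
  proof -
    have "row_mult_L2 (\<lambda>k x. (Yt k x - Yo k x) / dt) (gram_H emb Ut) j \<omega>
        = (transpose Sh1 *v (Sh1 *v ((1 / dt) *\<^sub>R (yt - v0)))) $ j" for j
    proof -
      have "(\<chi> k. (Yt k \<omega> - Yo k \<omega>) / dt) = (1 / dt) *\<^sub>R (yt - v0)"
        using assms(7)[OF \<omega>] by (simp add: vec_eq_iff yt_def v0_def)
      then show ?thesis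
        by (simp add: row_mult_L2_def row_mult_eq_matrix_vector gram matrix_transpose_mul
            matrix_vector_mul_assoc)
    qed
    moreover have "row_mult_L2 (\<lambda>k x. (Yt k x - Yo k x) / dt) (gram_H emb Ut) j \<omega>
       + orth_proj_L2 \<Gamma> wt (orth_compl_L2 \<Gamma> wt (span_L2 Yo)) (pairing_row Gs Ut j) \<omega> = 0" for j
      using A_modes \<omega> by blast
    ultimately have "transpose Sh1 *v (Sh1 *v ((1 / dt) *\<^sub>R (yt - v0)) + (g \<omega> - C *v v0)) = 0"
      unfolding proj by (simp add: vec_eq_iff matrix_vector_right_distrib)
    moreover have "invertible (transpose Sh1)"
      using assms(11) by (rule transpose_invertible)
    ultimately have "Sh1 *v ((1 / dt) *\<^sub>R (yt - v0)) + (g \<omega> - C *v v0) = 0"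
      by (metis invertible_def matrix_left_invertible_ker)
    then have "dt *\<^sub>R (Sh1 *v ((1 / dt) *\<^sub>R (yt - v0)) + (g \<omega> - C *v v0)) = 0"
      by simp
    then show ?thesis
      using \<open>dt > 0\<close> by (simp add: scaleR_add_right matrix_vector_mult_scaleR eq_neg_iff_add_eq_0
          del: scaleR_eq_0_iff)
  qed

  have St0: "St0 = Sh1 + dt *\<^sub>R C"
    using St0_entries by (simp add: vec_eq_iff C_def)
  have L1: "L1 i \<omega> = (St0 *v v0 - dt *\<^sub>R g \<omega>) $ i" for i
    using L1_def \<omega> by (simp add: row_mult_L2_def row_mult_eq_matrix_vector v0_def g_def)
  \<comment> \<open>The correction \<open>dt *\<^sub>R C\<close> in \<open>St0\<close> restores
    exactly the component along \<open>V0\<close> that the projection in Scheme A removes from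
    \<open>g \<omega>\<close>.\<close>
  have "St0 *v v0 - dt *\<^sub>R g \<omega> = Sh1 *v yt"
    using modes
    by (simp add: St0 algebra_simps flip: scaleR_matrix_vector_assoc)
  moreover have "(S1 *v (\<chi> k. V1 k \<omega>)) $ i = L1 i \<omega>" for i
    using V1 \<omega> by (simp add: row_mult_L2_def row_mult_eq_matrix_vector)
  ultimately have "S1 *v (\<chi> k. V1 k \<omega>) = Sh1 *v yt"
    by (simp add: vec_eq_iff L1)
  \<comment> \<open>Both sides are expansions in \<open>U1\<close>, so equal coefficient vectors
    suffice and the factors \<open>S1\<close> and \<open>V1\<close> are never compared separately
    with those of Scheme A.\<close>
  then have "combine (row_mult U1 S1) V1 \<omega> = combine Ut Yt \<omega>"
    by (simp add: Ut combine_row_mult yt_def)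
  with unew unew_hat means \<omega> show "unew_hat \<omega> = unew \<omega>"
    by simp
qed

end
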